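(* Let $\mathbf{Z}\in\mathbb{R}^{M\times M}$ be the impedance coupling matrix of the uniform linear array described in the context, let $\mathbf{h}_1,\dots,\mathbf{h}_U\in\mathbb{C}^M$ be the channel vectors of $U$ users, and fix a user $u\in\{1,\dots,U\}$. Consider the problem $$\max_{\mathbf{w}_u}\ \frac{\mathbf{w}_u^T\mathbf{h}_u\mathbf{h}_u^H\mathbf{w}_u^*}{\mathbf{w}_u^T\mathbf{Z}\mathbf{w}_u^*}\quad\text{subject to}\quad \mathbf{h}_i^T\mathbf{w}_u=0,\ i=1,\dots,U,\ i\ne u.$$ Let $N$ ($N\le U-1$) denote the dimension of the interference user space, i.e. the span of $\{\mathbf{h}_i:i\neq u\}$, and let $\mathbf{R}^u_{\rm int}=\sum_{i\ne u}\mathbf{h}_i\mathbf{h}_i^H=\mathbf{L}_u\boldsymbol{\Sigma}\mathbf{L}_u^H$ be an eigenvalue decomposition, where $\mathbf{L}_u\in\mathbb{C}^{M\times M}$ is the eigenvector matrix with $\mathbf{L}_u^H\mathbf{L}_u=\mathbf{I}_M$ and the eigenvalues in the diagonal matrix $\boldsymbol{\Sigma}$ are sorted in descending order. Then the optimal solution of the problem is, up to a scaling factor, given by $$\bar{\mathbf{w}}_u^{\rm I}=\mathbf{L}_u^*\begin{pmatrix}\mathbf{0}_N\\ \boldsymbol{\alpha}_u\end{pmatrix},$$ where $\mathbf{0}_N$ is the zero vector of size $N\times 1$ and $\boldsymbol{\alpha}_u\in\mathbb{C}^{(M-N)\times 1}$ is obtained by $$\boldsymbol{\alpha}_u=\boldsymbol{\Xi}_u^{-1}\boldsymbol{\eta}_u^*,$$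 where $\boldsymbol{\Xi}_u\in\mathbb{C}^{(M-N)\times(M-N)}$ and $\boldsymbol{\eta}_u\in\mathbb{C}^{(M-N)\times 1}$ are given respectively by the block partitions $$\mathbf{L}_u^H\mathbf{Z}\mathbf{L}_u=\begin{pmatrix}\boldsymbol{\Upsilon}&\boldsymbol{\Psi}\\ \boldsymbol{\Psi}^H&\boldsymbol{\Xi}_u\end{pmatrix}\qquad\text{and}\qquad \mathbf{L}_u^H\mathbf{h}_u=\begin{pmatrix}\boldsymbol{\gamma}\\ \boldsymbol{\eta}_u\end{pmatrix},$$ with $\boldsymbol{\Upsilon}\in\mathbb{C}^{N\times N}$, $\boldsymbol{\Psi}\in\mathbb{C}^{N\times(M-N)}$ and $\boldsymbol{\gamma}\in\mathbb{C}^{N\times 1}$.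
   Context: Notation: $(\cdot)^*$, $(\cdot)^T$, $(\cdot)^H$ denote entrywise complex conjugate (without transposition), transpose, and conjugate transpose; $\mathbf{I}_M$ is the $M\times M$ identity. The array consists of $M$ isotropic antennas placed on a line with uniform spacing $d$, $0<d<\lambda/2$, where $\lambda$ is the wavelength and $k=2\pi/\lambda$. Its impedance coupling matrix $\mathbf{Z}=(z_{mn})\in\mathbb{R}^{M\times M}$ has entries $z_{mm}=1$ and $z_{mn}=\frac{\sin[kd(n-m)]}{kd(n-m)}$ for $n\ne m$. The objective function is the power gain of user $u$ with precoding vector $\mathbf{w}_u\in\mathbb{C}^M$, $\mathbf{w}_u\neq\mathbf{0}$; it is invariant under scaling of $\mathbf{w}_u$. The constraints say that the transmission to user $u$ creates no interference to the other users.
   Formalization: The formula for α_u is corrected to (Ξ_u^* )^{-1} η_u^* (the printed Ξ_u^{-1} η_u^* fails when Ξ_u is not real), and optimality is claimed only when h_u is not in the span of the other users' channels, since otherwise the given vector is zero. *)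

theory Defs
  imports
    "HOL-Analysis.Analysis"
    "Jordan_Normal_Form.VS_Connect"
    "Jordan_Normal_Form.Gauss_Jordan_Elimination"
    "Jordan_Normal_Form.Schur_Decomposition"
begin

text \<open>Matrix indices start at 0; the entries depend on the index difference only, so
  this agrees with the 1-based formula. The wave number is \<open>k = 2 * pi / lam\<close>.\<close>

definition impedance_matrix :: "real \<Rightarrow> real \<Rightarrow> nat \<Rightarrow> real mat" where
  "impedance_matrix lam d M = mat M M (\<lambda>(m, n).
     if m = n then 1
     else let x = (2 * pi / lam) * d * (real n - real m) in sin x / x)"

definition hermitian_outer :: "complex vec \<Rightarrow> complex vec \<Rightarrow> complex mat" where
  "hermitian_outer x y = mat (dim_vec x) (dim_vec y) (\<lambda>(a, b). x $ a * cnj (y $ b))"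

text \<open>The library product \<open>\<bullet>\<close> on vectors is bilinear, so \<open>w \<bullet> (A *\<^sub>v conjugate w)\<close> is
  w-transpose times A times w-conjugate. Both quadratic forms below are real when Z is real
  symmetric; the real part only turns the quotient into an element of type \<open>real\<close>.\<close>

definition power_gain :: "complex mat \<Rightarrow> complex vec \<Rightarrow> complex vec \<Rightarrow> real" where
  "power_gain Z h w =
     Re ((w \<bullet> (hermitian_outer h h *\<^sub>v conjugate w)) / (w \<bullet> (Z *\<^sub>v conjugate w)))"

definition no_interference :: "nat \<Rightarrow> nat \<Rightarrow> (nat \<Rightarrow> complex vec) \<Rightarrow> nat \<Rightarrow> complex vec \<Rightarrow> bool" where
  "no_interference M U h u w \<longleftrightarrow>
     w \<in> carrier_vec M \<and> w \<noteq> 0\<^sub>v M \<and> (\<forall>i\<in>{1..U} - {u}. h i \<bullet> w = 0)"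

definition interference_space :: "nat \<Rightarrow> nat \<Rightarrow> (nat \<Rightarrow> complex vec) \<Rightarrow> nat \<Rightarrow> complex vec set" where
  "interference_space M U h u =
     LinearCombinations.module.span class_ring (module_vec TYPE(complex) M) (h ` ({1..U} - {u}))"

definition interference_dim :: "nat \<Rightarrow> nat \<Rightarrow> (nat \<Rightarrow> complex vec) \<Rightarrow> nat \<Rightarrow> nat" where
  "interference_dim M U h u =
     vectorspace.dim class_ring
       ((module_vec TYPE(complex) M)\<lparr>carrier := interference_space M U h u\<rparr>)"

text \<open>Written entrywise because matrices of variable size form no additive monoid type.\<close>

definition interference_matrix :: "nat \<Rightarrow> nat \<Rightarrow> (nat \<Rightarrow> complex vec) \<Rightarrow> nat \<Rightarrow> complex mat" where
  "interference_matrix M U h u =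
     mat M M (\<lambda>(a, b). \<Sum>i\<in>{1..U} - {u}. hermitian_outer (h i) (h i) $$ (a, b))"

text \<open>The matrix decomposed here is Hermitian in all uses, so the diagonal of S is real and
  comparing real parts is the descending order of the eigenvalues.\<close>

definition sorted_eigen_decomposition ::
    "nat \<Rightarrow> complex mat \<Rightarrow> complex mat \<Rightarrow> complex mat \<Rightarrow> bool" where
  "sorted_eigen_decomposition M R L S \<longleftrightarrow>
     L \<in> carrier_mat M M \<and> S \<in> carrier_mat M M \<and> diagonal_mat S \<and>
     mat_adjoint L * L = 1\<^sub>m M \<and> R = L * S * mat_adjoint L \<and>
     (\<forall>i j. i \<le> j \<and> j < M \<longrightarrow> Re (S $$ (j, j)) \<le> Re (S $$ (i, i)))"

end

theory Submission
  imports Defs "Jordan_Normal_Form.DL_Rank"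
begin

text \<open>Since \<open>sin x / x\<close> is half the integral of \<open>exp (i x t)\<close> over \<open>[-1, 1]\<close>, the quadratic form of
  \<open>Z\<close> at \<open>w\<close> is half the integral of \<open>|\<Sum>m. w\<^sub>m exp (- i \<kappa> m t)|\<^sup>2\<close> with \<open>\<kappa> = k d \<in> (0, \<pi>)\<close>. It is
  positive, as a nonzero polynomial does not vanish on an arc of the unit circle. The nonzero
  eigenvalues of the interference matrix belong to the first \<open>N\<close> columns of \<open>L\<close>, and these columns
  span the interference space. Hence the feasible vectors are the \<open>L\<^sup>* (0, b)\<close>, on which the form of
  \<open>Z\<close> is given by \<open>\<Xi>\<close>. The vector \<open>wbar\<close> represents the functional \<open>w \<mapsto> w\<^sup>T h\<^sub>u\<close> on the feasible vectors
  with respect to this form, so the theorem is the Cauchy--Schwarz inequality with its equality case.\<close>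

section \<open>Adjoint and entrywise conjugate\<close>

lemma mat_adjoint_carrier [simp]:
  "A \<in> carrier_mat n m \<Longrightarrow> mat_adjoint A \<in> carrier_mat m n"
  by (auto simp: mat_adjoint_def)

lemma mat_adjoint_index:
  assumes "A \<in> carrier_mat n m" "i < m" "j < n"
  shows "mat_adjoint A $$ (i, j) = conjugate (A $$ (j, i))"
  using assms by (simp add: mat_adjoint_def mat_of_rows_index)

lemma conjugate_mult_mat_vec:
  fixes A :: "complex mat"
  assumes "A \<in> carrier_mat n m" "x \<in> carrier_vec m"
  shows "conjugate (A *\<^sub>v x) = map_mat cnj A *\<^sub>v conjugate x"
  using assms by (intro eq_vecI) (auto simp: scalar_prod_def cnj_sum)

lemma mat_adjoint_dim [simp]: "dim_row (mat_adjoint A) = dim_col A" "dim_col (mat_adjoint A) = dim_row A"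
  by (auto simp: mat_adjoint_def)

lemma map_mat_cnj_eq_transpose_adjoint:
  fixes A :: "complex mat"
  assumes "A \<in> carrier_mat n m"
  shows "map_mat cnj A = transpose_mat (mat_adjoint A)"
  using assms by (intro eq_matI) (auto simp: mat_adjoint_index)

text \<open>The entrywise conjugate is the transpose of the adjoint, so it crosses the bilinear
  product as the adjoint. This turns the \<open>L\<^sup>*\<close> of a beamformer into
  \<open>L\<^sup>H\<close> acting on a channel.\<close>

lemma map_mat_cnj_scalar_prod:
  fixes A :: "complex mat"
  assumes "A \<in> carrier_mat n m" "b \<in> carrier_vec m" "y \<in> carrier_vec n"
  shows "(map_mat cnj A *\<^sub>v b) \<bullet> y = b \<bullet> (mat_adjoint A *\<^sub>v y)"
  unfolding map_mat_cnj_eq_transpose_adjoint[OF assms(1)]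
  by (rule transpose_vec_mult_scalar[of _ m n]) (use assms in auto)

section \<open>Positivity and symmetry of the impedance form\<close>

lemma sinc_has_integral:
  fixes x :: real
  assumes "x \<noteq> 0"
  shows "((\<lambda>t. cis (x * t)) has_integral complex_of_real (2 * (sin x / x))) {-1..1}"
proof -
  let ?c = "\<i> * complex_of_real x"
  have c: "?c \<noteq> 0" using assms by simp
  have "((\<lambda>t. exp (complex_of_real t * ?c)) has_integral
      exp (complex_of_real 1 * ?c) / ?c - exp (complex_of_real (-1) * ?c) / ?c) {-1..1}"
  proof (rule fundamental_theorem_of_calculus)
    fix t :: real
    have "((\<lambda>z. exp (z * ?c) / ?c) has_field_derivative exp (of_real t * ?c)) (at (of_real t))"
      using c by (auto intro!: derivative_eq_intros simp: field_simps)
    then show "((\<lambda>t. exp (complex_of_real t * ?c) / ?c) has_vector_derivative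
        exp (complex_of_real t * ?c)) (at t within {-1..1})"
      by (rule has_vector_derivative_real_field)
  qed simp
  moreover have "exp (complex_of_real t * ?c) = cis (x * t)" for t
    by (simp add: cis_conv_exp mult_ac)
  moreover have "exp (complex_of_real 1 * ?c) = cis (x * 1)" "exp (complex_of_real (-1) * ?c) = cis (x * (- 1))"
    by (simp_all add: cis_conv_exp)
  \<comment> \<open>In the difference of the endpoint values the cosines cancel and the sines add
    up.\<close>
  moreover have "cis (x * 1) / ?c - cis (x * (- 1)) / ?c = complex_of_real (2 * (sin x / x))"
    using assms by (simp add: complex_eq_iff Re_divide Im_divide power2_eq_square)
  ultimately show ?thesis by simp
qed

text \<open>The sum is a polynomial with coefficients \<open>c\<close>, evaluated on the unit
  circle. As \<open>\<kappa> < pi\<close> makes \<open>t \<mapsto> cis (\<kappa> * t)\<close>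
  injective on \<open>[-1, 1]\<close>, a nonzero coefficient would give a nonzero polynomial with
  infinitely many roots.\<close>

lemma cis_sum_eq_0_imp_coeff_0:
  fixes c :: "nat \<Rightarrow> complex"
  assumes \<kappa>: "0 < \<kappa>" "\<kappa> < pi"
    and zero: "\<And>t. t \<in> {-1..1} \<Longrightarrow> (\<Sum>m<M. c m * cis (- (\<kappa> * real m * t))) = 0"
    and m: "m < M"
  shows "c m = 0"
proof (rule ccontr)
  assume "c m \<noteq> 0"
  have M: "{..<M} = {..M - 1}" using m by auto
  have "finite {z. (\<Sum>i\<le>M - 1. c i * z ^ i) = 0}"
    using polyfun_finite_roots[of c "M - 1"] \<open>c m \<noteq> 0\<close> m by auto
  moreover have "(\<lambda>t. cis (\<kappa> * t)) ` {-1..1} \<subseteq> {z. (\<Sum>i\<le>M - 1. c i * z ^ i) = 0}"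
  proof clarify
    fix t :: real assume "t \<in> {-1..1}"
    \<comment> \<open>The frequencies in the assumption are negative. Since \<open>[-1, 1]\<close>
      is symmetric, passing to \<open>- t\<close> turns them into powers of
      \<open>cis (\<kappa> * t)\<close>.\<close>
    moreover have "cis (\<kappa> * t) ^ i = cis (- (\<kappa> * real i * - t))" for i
      by (subst Complex.DeMoivre) (simp add: mult_ac)
    ultimately show "(\<Sum>i\<le>M - 1. c i * cis (\<kappa> * t) ^ i) = 0"
      using zero[of "- t"] by (simp add: M)
  qed
  ultimately have "finite ((\<lambda>t. cis (\<kappa> * t)) ` {-1..1})"
    using finite_subset by blast
  moreover have "inj_on (\<lambda>t. cis (\<kappa> * t)) {-1..1}"
  proof (rule inj_onI)
    fix s t :: real assume *: "s \<in> {-1..1}" "t \<in> {-1..1}" "cis (\<kappa> * s) = cis (\<kappa> * t)"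
    \<comment> \<open>The angle stays strictly between \<open>- pi\<close> and \<open>pi\<close>, so
      the principal argument recovers it.\<close>
    have "Arg (cis (\<kappa> * r)) = \<kappa> * r" if "r \<in> {-1..1}" for r
    proof (rule Arg_cis)
      have "\<kappa> * \<bar>r\<bar> \<le> \<kappa> * 1" using that \<kappa> by (intro mult_left_mono) auto
      then have "\<bar>\<kappa> * r\<bar> < pi" using \<kappa> by (simp only: abs_mult abs_of_pos)
      then show "\<kappa> * r \<in> {-pi<..pi}" by (simp only: greaterThanAtMost_iff abs_less_iff, linarith)
    qed
    from this[OF *(1)] this[OF *(2)] *(3) have "\<kappa> * s = \<kappa> * t" by metis
    then show "s = t" using \<kappa> by simp
  qed
  ultimately have "finite {-1..1::real}" by (rule finite_imageD)
  then show False using infinite_Icc[of "-1 :: real" 1] by simp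
qed

lemma scalar_prod_mult_mat_vec_eq_sum:
  assumes "A \<in> carrier_mat n m" "x \<in> carrier_vec n" "y \<in> carrier_vec m"
  shows "x \<bullet> (A *\<^sub>v y) = (\<Sum>i<n. \<Sum>j<m. x $ i * A $$ (i, j) * y $ j)"
  using assms by (auto simp: scalar_prod_def sum_distrib_left mult_ac lessThan_atLeast0)

lemma impedance_matrix_index:
  assumes "m < M" "n < M" "m \<noteq> n"
  shows "impedance_matrix lam d M $$ (m, n) =
    sin (2 * pi / lam * d * (real n - real m)) / (2 * pi / lam * d * (real n - real m))"
  using assms by (simp add: impedance_matrix_def Let_def)

lemma impedance_matrix_carrier [simp]: "impedance_matrix lam d M \<in> carrier_mat M M"
  by (simp add: impedance_matrix_def)

lemma impedance_form_pos:
  assumes d: "0 < d" "d < lam / 2"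
    and w: "w \<in> carrier_vec M" "w \<noteq> 0\<^sub>v M"
  shows "0 < Re (w \<bullet> (map_mat complex_of_real (impedance_matrix lam d M) *\<^sub>v conjugate w))"
    (is "0 < Re (w \<bullet> (?Z *\<^sub>v conjugate w))")
proof -
  define \<kappa> where "\<kappa> = 2 * pi / lam * d"
  have \<kappa>: "0 < \<kappa>" "\<kappa> < pi" using d by (auto simp: \<kappa>_def field_simps)
  \<comment> \<open>\<open>F\<close> is the far-field pattern of the array, with \<open>t\<close> in
    the role of the direction cosine.\<close>
  define F where "F t = (\<Sum>m<M. w $ m * cis (- (\<kappa> * real m * t)))" for t
  let ?q = "w \<bullet> (?Z *\<^sub>v conjugate w)"
  have entry: "((\<lambda>t. cis (\<kappa> * (real n - real m) * t)) has_integral 2 * ?Z $$ (m, n)) {-1..1}"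
    if "m < M" "n < M" for m n
  proof (cases "m = n")
    \<comment> \<open>On the diagonal the sinc quotient would be 0/0; there the integrand is the
      constant 1.\<close>
    case True
    then show ?thesis using that has_integral_const_real[of "1::complex" "-1" 1]
      by (simp add: impedance_matrix_def scaleR_conv_of_real)
  next
    case False
    have "?Z $$ (m, n) = complex_of_real (impedance_matrix lam d M $$ (m, n))"
      using that by (simp add: impedance_matrix_def)
    also have "\<dots> = complex_of_real (sin (\<kappa> * (real n - real m)) / (\<kappa> * (real n - real m)))"
      by (simp only: impedance_matrix_index[OF that False] \<kappa>_def)
    finally show ?thesis
      using False \<kappa>(1) sinc_has_integral[of "\<kappa> * (real n - real m)"] by simp
  qed
  have "((\<lambda>t. \<Sum>m<M. \<Sum>n<M. w $ m * cnj (w $ n) * cis (\<kappa> * (real n - real m) * t)) has_integral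
      (\<Sum>m<M. \<Sum>n<M. w $ m * cnj (w $ n) * (2 * ?Z $$ (m, n)))) {-1..1}"
    by (intro has_integral_sum has_integral_mult_right entry) auto
  moreover have "(\<Sum>m<M. \<Sum>n<M. w $ m * cnj (w $ n) * (2 * ?Z $$ (m, n))) = 2 * ?q"
    using w(1) by (subst scalar_prod_mult_mat_vec_eq_sum[of _ M M])
      (auto simp: sum_distrib_left mult_ac impedance_matrix_def intro!: sum.cong)
  moreover have "(\<Sum>m<M. \<Sum>n<M. w $ m * cnj (w $ n) * cis (\<kappa> * (real n - real m) * t))
      = complex_of_real ((cmod (F t))\<^sup>2)" for t
  proof -
    have "complex_of_real ((cmod (F t))\<^sup>2) = F t * cnj (F t)"
      by (rule complex_norm_square)
    also have "\<dots> = (\<Sum>m<M. \<Sum>n<M. w $ m * cnj (w $ n) *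
        (cis (- (\<kappa> * real m * t)) * cis (\<kappa> * real n * t)))"
      by (simp add: F_def cnj_sum sum_product cis_cnj mult_ac)
    finally show ?thesis by (simp add: cis_mult algebra_simps)
  qed
  ultimately have "((\<lambda>t. complex_of_real ((cmod (F t))\<^sup>2)) has_integral 2 * ?q) {-1..1}"
    by simp
  from has_integral_Re[OF this]
  have int: "((\<lambda>t. (cmod (F t))\<^sup>2) has_integral 2 * Re ?q) {-1..1}" by simp
  have "0 \<le> 2 * Re ?q" by (rule has_integral_nonneg[OF int]) simp
  moreover have "Re ?q \<noteq> 0"
  proof
    assume "Re ?q = 0"
    \<comment> \<open>Continuity makes a nonnegative integrand with integral zero vanish at every
      point, not merely almost everywhere.\<close>
    have cont: "continuous_on (cbox (-1) 1) (\<lambda>t. (cmod (F t))\<^sup>2)"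
      unfolding F_def cis_conv_exp by (intro continuous_intros)
    have "F t = 0" if "t \<in> {-1..1}" for t
      using has_integral_0_cbox_imp_0[OF cont, of t] int \<open>Re ?q = 0\<close> that by simp
    then have "w $ m = 0" if "m < M" for m
      using cis_sum_eq_0_imp_coeff_0[OF \<kappa> _ that, of "\<lambda>m. w $ m"] by (simp add: F_def)
    then show False using w by (auto simp: vec_eq_iff)
  qed
  ultimately show ?thesis by simp
qed

text \<open>The matrix is real, and symmetric because sinc is even; exchanging the two summations
  then conjugates the form.\<close>

lemma impedance_form_hermitian:
  assumes "v \<in> carrier_vec M" "w \<in> carrier_vec M"
    and Z: "Z = map_mat complex_of_real (impedance_matrix lam d M)"
  shows "v \<bullet> (Z *\<^sub>v conjugate w) = cnj (w \<bullet> (Z *\<^sub>v conjugate v))"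
proof -
  have Zc: "Z \<in> carrier_mat M M" by (simp add: Z impedance_matrix_def)
  have sym: "cnj (Z $$ (m, n)) = Z $$ (n, m)" if "m < M" "n < M" for m n
  proof -
    have "sin (c * (real n - real m)) / (c * (real n - real m)) =
        sin (c * (real m - real n)) / (c * (real m - real n))" for c
    proof -
      have "c * (real n - real m) = - (c * (real m - real n))" by (simp add: algebra_simps)
      then show ?thesis by (simp only: sin_minus minus_divide_divide)
    qed
    from this[of "2 * pi / lam * d"] show ?thesis
      using that impedance_matrix_index[OF that, of lam d] impedance_matrix_index[OF that(2,1), of lam d]
      by (cases "m = n") (simp_all only: Z impedance_matrix_carrier[THEN carrier_matD(1)]
        impedance_matrix_carrier[THEN carrier_matD(2)] index_map_mat not_sym complex_cnj_complex_of_real simp_thms)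
  qed
  have "v \<bullet> (Z *\<^sub>v conjugate w) = (\<Sum>n<M. \<Sum>m<M. v $ n * Z $$ (n, m) * cnj (w $ m))"
    using assms Zc by (subst scalar_prod_mult_mat_vec_eq_sum[OF Zc]) auto
  also have "\<dots> = (\<Sum>m<M. \<Sum>n<M. v $ n * Z $$ (n, m) * cnj (w $ m))"
    by (rule sum.swap)
  also have "\<dots> = cnj (\<Sum>m<M. \<Sum>n<M. w $ m * Z $$ (m, n) * cnj (v $ n))"
    by (simp add: cnj_sum sym mult_ac)
  also have "\<dots> = cnj (w \<bullet> (Z *\<^sub>v conjugate v))"
    using assms Zc by (subst scalar_prod_mult_mat_vec_eq_sum[OF Zc]) auto
  finally show ?thesis .
qed

section \<open>Maximising the gain by Cauchy--Schwarz\<close>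

lemma conjugate_minus_smult:
  fixes v w :: "complex vec"
  assumes "v \<in> carrier_vec n" "w \<in> carrier_vec n"
  shows "conjugate (w - c \<cdot>\<^sub>v v) = conjugate w - cnj c \<cdot>\<^sub>v conjugate v"
  using assms by (intro eq_vecI) auto

lemma hermitian_outer_form:
  assumes "w \<in> carrier_vec n" "h \<in> carrier_vec n"
  shows "w \<bullet> (hermitian_outer h h *\<^sub>v conjugate w) = complex_of_real ((cmod (w \<bullet> h))\<^sup>2)"
proof -
  have "w \<bullet> (hermitian_outer h h *\<^sub>v conjugate w) =
      (\<Sum>i<n. \<Sum>j<n. w $ i * hermitian_outer h h $$ (i, j) * conjugate w $ j)"
    using assms by (intro scalar_prod_mult_mat_vec_eq_sum) (auto simp: hermitian_outer_def)
  also have "\<dots> = (\<Sum>i<n. \<Sum>j<n. (w $ i * h $ i) * cnj (w $ j * h $ j))"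
    using assms by (auto simp: hermitian_outer_def mult_ac intro!: sum.cong)
  also have "\<dots> = (w \<bullet> h) * cnj (w \<bullet> h)"
    using assms by (simp add: scalar_prod_def sum_product cnj_sum lessThan_atLeast0)
  finally show ?thesis by (simp only: complex_norm_square)
qed

text \<open>In the inner product \<open>x \<bullet> (Z *\<^sub>v conjugate y)\<close>, assumption
  \<open>repr\<close> makes \<open>w \<bullet> h\<close> the product of \<open>w\<close> with
  \<open>v\<close>. The gain is then the squared modulus of that product over the squared norm of
  \<open>w\<close>, hence at most the squared norm of \<open>v\<close>, with equality exactly on the
  multiples of \<open>v\<close>. Representation is asked on \<open>F\<close> only, because
  \<open>v\<close> reproduces the functional on feasible vectors and not on the whole space.\<close>

lemma is_arg_max_power_gain_iff:
  assumes Z: "Z \<in> carrier_mat n n" and h: "h \<in> carrier_vec n"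
    and herm: "\<And>v w. v \<in> carrier_vec n \<Longrightarrow> w \<in> carrier_vec n \<Longrightarrow>
      v \<bullet> (Z *\<^sub>v conjugate w) = cnj (w \<bullet> (Z *\<^sub>v conjugate v))"
    and pos: "\<And>w. w \<in> carrier_vec n \<Longrightarrow> w \<noteq> 0\<^sub>v n \<Longrightarrow> 0 < Re (w \<bullet> (Z *\<^sub>v conjugate w))"
    and F: "\<And>w. F w \<Longrightarrow> w \<in> carrier_vec n \<and> w \<noteq> 0\<^sub>v n"
    and scale: "\<And>c. c \<noteq> 0 \<Longrightarrow> F (c \<cdot>\<^sub>v v)"
    and repr: "\<And>w. F w \<Longrightarrow> w \<bullet> (Z *\<^sub>v conjugate v) = w \<bullet> h"
  shows "is_arg_max (power_gain Z h) F w \<longleftrightarrow> (\<exists>c. c \<noteq> 0 \<and> w = c \<cdot>\<^sub>v v)"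
proof -
  define q where "q x = Re (x \<bullet> (Z *\<^sub>v conjugate x))" for x
  have q: "x \<bullet> (Z *\<^sub>v conjugate x) = complex_of_real (q x)" if "x \<in> carrier_vec n" for x
    using herm[OF that that] by (simp add: q_def complex_eq_iff)
  have q_pos: "0 < q x" if "x \<in> carrier_vec n" "x \<noteq> 0\<^sub>v n" for x
    using pos[OF that] by (simp add: q_def)
  \<comment> \<open>Feasibility of \<open>v\<close>, and with it \<open>v \<noteq> 0\<close>, is the
    case \<open>c = 1\<close> of \<open>scale\<close>.\<close>
  have Fv: "F v" using scale[of 1] by simp
  then have v: "v \<in> carrier_vec n" "v \<noteq> 0\<^sub>v n" using F by auto
  have qv: "0 < q v" using q_pos v by simp
  have gain: "power_gain Z h x = (cmod (x \<bullet> h))\<^sup>2 / q x" if "F x" for x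
    using F[OF that] by (simp add: power_gain_def hermitian_outer_form[OF _ h] q flip: of_real_divide)
  \<comment> \<open>The form of the component of \<open>x\<close> orthogonal to \<open>v\<close>; it is nonnegative, and zero only if \<open>x\<close> is a
    multiple of \<open>v\<close>.\<close>
  have residual: "q (x - (x \<bullet> h / q v) \<cdot>\<^sub>v v) = q x - (cmod (x \<bullet> h))\<^sup>2 / q v" if "F x" for x
  proof -
    have x: "x \<in> carrier_vec n" using F[OF that] by simp
    define s where "s = x \<bullet> h"
    define c where "c = s / q v"
    let ?r = "x - c \<cdot>\<^sub>v v"
    have r: "?r \<in> carrier_vec n" using x v by simp
    have Zr: "Z *\<^sub>v conjugate ?r = Z *\<^sub>v conjugate x - cnj c \<cdot>\<^sub>v (Z *\<^sub>v conjugate v)"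
      using Z x v by (simp add: conjugate_minus_smult mult_minus_distrib_mat_vec mult_mat_vec)
    have expand: "?r \<bullet> (y - cnj c \<cdot>\<^sub>v z) = x \<bullet> y - cnj c * (x \<bullet> z) - c * (v \<bullet> y) + c * cnj c * (v \<bullet> z)"
      if "y \<in> carrier_vec n" "z \<in> carrier_vec n" for y z
      using that x v
      by (simp add: minus_scalar_prod_distrib[of _ n] scalar_prod_minus_distrib[of _ n] algebra_simps)
    have "complex_of_real (q ?r) = ?r \<bullet> (Z *\<^sub>v conjugate ?r)" using q[OF r] by simp
    \<comment> \<open>The first mixed term is \<open>s\<close> by \<open>repr\<close>; the second is
      its conjugate by \<open>herm\<close>.\<close>
    also have "\<dots> = q x - cnj c * s - c * cnj s + c * cnj c * q v"
      unfolding Zr using Z x v repr[OF that] herm[OF v(1) x]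
      by (subst expand) (auto simp: q s_def)
    also have "\<dots> = q x - (s * cnj s) / q v"
      using qv by (simp add: c_def field_simps)
    also have "\<dots> = complex_of_real (q x - (cmod s)\<^sup>2 / q v)"
      by (simp only: complex_norm_square[symmetric] of_real_diff of_real_divide)
    finally show ?thesis unfolding of_real_eq_iff s_def c_def .
  qed
  \<comment> \<open>The bound on the gain is nonnegativity of the residual, multiplied by
    \<open>q v / q x\<close>.\<close>
  have gain_le: "power_gain Z h x \<le> q v" and
    gain_eq: "power_gain Z h x = q v \<Longrightarrow> x = (x \<bullet> h / q v) \<cdot>\<^sub>v v" if "F x" for x
  proof -
    have x: "x \<in> carrier_vec n" "x \<noteq> 0\<^sub>v n" using F[OF that] by auto
    let ?r = "x - (x \<bullet> h / q v) \<cdot>\<^sub>v v"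
    have r: "?r \<in> carrier_vec n" using x v by simp
    have "0 \<le> q ?r"
      using q_pos[OF r] Z by (cases "?r = 0\<^sub>v n") (auto simp: q_def)
    then show "power_gain Z h x \<le> q v"
      using residual[OF that] q_pos[OF x] qv by (simp add: gain[OF that] field_simps)
    assume "power_gain Z h x = q v"
    then have "q ?r = 0"
      using residual[OF that] q_pos[OF x] qv by (simp add: gain[OF that] field_simps)
    then have "?r = 0\<^sub>v n" using q_pos[OF r] by fastforce
    then show "x = (x \<bullet> h / q v) \<cdot>\<^sub>v v"
      using x v by (auto simp: vec_eq_iff)
  qed
  have gain_scaled: "power_gain Z h (c \<cdot>\<^sub>v v) = q v" if "c \<noteq> 0" for c
  proof -
    have "q (c \<cdot>\<^sub>v v) = (cmod c)\<^sup>2 * q v"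
    proof -
      have "conjugate (c \<cdot>\<^sub>v v) = cnj c \<cdot>\<^sub>v conjugate v" by (rule eq_vecI) auto
      then have "complex_of_real (q (c \<cdot>\<^sub>v v)) = c * cnj c * q v"
        using v Z q[of "c \<cdot>\<^sub>v v"] q[OF v(1)] by (simp add: mult_mat_vec mult_ac)
      then have "complex_of_real (q (c \<cdot>\<^sub>v v)) = complex_of_real ((cmod c)\<^sup>2 * q v)"
        by (simp only: complex_norm_square[symmetric] of_real_mult)
      then show ?thesis by (simp only: of_real_eq_iff)
    qed
    \<comment> \<open>Applying \<open>repr\<close> to \<open>v\<close> itself shows that the bound
      \<open>q v\<close> is attained.\<close>
    moreover have "v \<bullet> h = q v" using repr[OF Fv] q[OF v(1)] by simp
    ultimately show ?thesis
      using gain[OF scale[OF that]] v h qv that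
      by (simp add: norm_mult power_mult_distrib power2_eq_square)
  qed
  have "power_gain Z h v = q v" using gain_scaled[of 1] by simp
  show ?thesis
  proof
    assume w: "is_arg_max (power_gain Z h) F w"
    then have Fw: "F w" and "\<not> power_gain Z h v > power_gain Z h w"
      using Fv by (auto simp: is_arg_max_def)
    then have "w = (w \<bullet> h / q v) \<cdot>\<^sub>v v"
      using gain_le[OF Fw] \<open>power_gain Z h v = q v\<close> by (intro gain_eq) auto
    moreover have "w \<bullet> h / q v \<noteq> 0"
    proof
      assume "w \<bullet> h / q v = 0"
      with calculation have "w = 0 \<cdot>\<^sub>v v" by (simp only:)
      then show False using F[OF Fw] v by auto
    qed
    ultimately show "\<exists>c. c \<noteq> 0 \<and> w = c \<cdot>\<^sub>v v" by blast
  next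
    assume "\<exists>c. c \<noteq> 0 \<and> w = c \<cdot>\<^sub>v v"
    then show "is_arg_max (power_gain Z h) F w"
      using scale gain_scaled gain_le by (auto simp: is_arg_max_def not_less)
  qed
qed

section \<open>Spans of columns and their dimension\<close>

text \<open>Summation is over indices, so coinciding vectors \<open>g i\<close> are allowed, whereas
  \<open>lincomb\<close> sums over a set of vectors. Channels of different users may
  coincide.\<close>

lemma sum_in_span:
  fixes g :: "'i \<Rightarrow> 'a :: field vec"
  assumes "finite I" "\<And>i. i \<in> I \<Longrightarrow> g i \<in> carrier_vec n"
  shows "vec n (\<lambda>p. \<Sum>i\<in>I. c i * g i $ p)
    \<in> LinearCombinations.module.span class_ring (module_vec TYPE('a) n) (g ` I)"
proof -
  interpret vec_space "TYPE('a)" n .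
  \<comment> \<open>Only the range of summation grows in the induction; the span stays that of the
    whole family.\<close>
  have "vec n (\<lambda>p. \<Sum>i\<in>J. c i * g i $ p) \<in> span (g ` I)" if "J \<subseteq> I" for J
    using finite_subset[OF that assms(1)] that
  proof (induction J rule: finite_induct)
    case empty
    have "vec n (\<lambda>p. \<Sum>i\<in>{}. c i * g i $ p) = 0\<^sub>v n" by auto
    then show ?case by (intro in_spanI[of _ undefined "{}"]) (auto simp: lincomb_def)
  next
    case (insert i J)
    have gI: "g ` I \<subseteq> carrier_vec n" using assms(2) by auto
    have gi: "g i \<in> carrier_vec n" using insert.prems assms(2) by auto
    have "vec n (\<lambda>p. \<Sum>i\<in>insert i J. c i * g i $ p) =
        c i \<cdot>\<^sub>v g i + vec n (\<lambda>p. \<Sum>i\<in>J. c i * g i $ p)"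
      using insert.hyps gi by (intro eq_vecI) auto
    moreover have "c i \<cdot>\<^sub>v g i \<in> span (g ` I)"
      using insert.prems gI by (intro smult_in_span span_mem) auto
    ultimately show ?case
      using span_add1[OF gI] insert by simp
  qed
  then show ?thesis by blast
qed

text \<open>Equal columns \<open>i\<close> and \<open>j\<close> would make the entries
  \<open>(i, j)\<close> and \<open>(i, i)\<close> of the identity equal. A linear dependency is a
  nonzero kernel vector of \<open>L\<close>, which the left inverse sends back to itself and to
  zero.\<close>

lemma
  fixes L :: "complex mat"
  assumes L: "L \<in> carrier_mat n n" and LL: "mat_adjoint L * L = 1\<^sub>m n"
  shows unitary_inj_on_col: "inj_on (col L) {..<n}"
    and unitary_lin_indpt_cols: "\<not> LinearCombinations.module.lin_dep class_ring
      (module_vec TYPE(complex) n) (col L ` {..<n})"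
proof -
  interpret vec_space "TYPE(complex)" n .
  show inj: "inj_on (col L) {..<n}"
  proof (rule inj_onI)
    fix i j assume *: "i \<in> {..<n}" "j \<in> {..<n}" "col L i = col L j"
    have "(mat_adjoint L * L) $$ (i, j) = (mat_adjoint L * L) $$ (i, i)"
      using L * by simp
    then show "i = j" unfolding LL using * by (auto split: if_splits)
  qed
  have cols: "set (cols L) = col L ` {..<n}"
    using L by (auto simp: cols_def)
  show "\<not> lin_dep (col L ` {..<n})"
  proof
    assume "lin_dep (col L ` {..<n})"
    moreover have "distinct (cols L)"
      using inj L by (simp add: cols_def distinct_map lessThan_atLeast0)
    ultimately obtain x where x: "x \<in> carrier_vec n" "x \<noteq> 0\<^sub>v n" "L *\<^sub>v x = 0\<^sub>v n"
      using lin_depE[OF L] cols by auto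
    have "x = (mat_adjoint L * L) *\<^sub>v x" using LL x by simp
    also have "\<dots> = mat_adjoint L *\<^sub>v (L *\<^sub>v x)" using L x by (intro assoc_mult_mat_vec) auto
    also have "\<dots> = 0\<^sub>v n" using L by (simp add: x(3)) (auto intro!: eq_vecI)
    finally show False using x(2) by simp
  qed
qed

lemma dim_span_unitary_cols:
  fixes L :: "complex mat"
  assumes L: "L \<in> carrier_mat n n" "mat_adjoint L * L = 1\<^sub>m n" and r: "r \<le> n"
  shows "vectorspace.dim class_ring ((module_vec TYPE(complex) n)\<lparr>carrier :=
    LinearCombinations.module.span class_ring (module_vec TYPE(complex) n) (col L ` {..<r})\<rparr>) = r"
proof -
  interpret vec_space "TYPE(complex)" n .
  have sub: "col L ` {..<r} \<subseteq> col L ` {..<n}" using r by auto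
  \<comment> \<open>An independent set is its own maximal independent subset, so the dimension is
    its cardinality.\<close>
  have "maximal (col L ` {..<r}) (\<lambda>T. T \<subseteq> col L ` {..<r} \<and> lin_indpt T)"
    using subset_li_is_li[OF unitary_lin_indpt_cols[OF L] sub] by (auto simp: maximal_def)
  then have "vectorspace.dim class_ring (span_vs (col L ` {..<r})) = card (col L ` {..<r})"
    using L(1) by (intro dim_span) auto
  also have "\<dots> = r"
    using inj_on_subset[OF unitary_inj_on_col[OF L], of "{..<r}"] r by (simp add: card_image)
  finally show ?thesis .
qed

section \<open>Eigenvectors of the interference matrix\<close>

lemma sorted_nonneg_nonzero_prefix:
  fixes f :: "nat \<Rightarrow> real"
  assumes "\<And>j. j < n \<Longrightarrow> 0 \<le> f j" "\<And>i j. i \<le> j \<Longrightarrow> j < n \<Longrightarrow> f j \<le> f i"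
  shows "\<exists>r\<le>n. \<forall>j<n. f j \<noteq> 0 \<longleftrightarrow> j < r"
proof (intro exI conjI allI impI)
  \<comment> \<open>\<open>r\<close> is the first zero of \<open>f\<close>; the disjunct
    \<open>j = n\<close> covers the case that no value vanishes. Beyond \<open>r\<close> the values
    lie between 0 and \<open>f r = 0\<close>.\<close>
  define r where "r = (LEAST j. j = n \<or> f j = 0)"
  show "r \<le> n" unfolding r_def by (rule Least_le) simp
  have r: "r = n \<or> f r = 0" unfolding r_def by (rule LeastI[of _ n]) simp
  show "f j \<noteq> 0 \<longleftrightarrow> j < r" if "j < n" for j
  proof
    assume "f j \<noteq> 0"
    show "j < r"
    proof (rule ccontr)
      assume "\<not> j < r"
      then have "f r = 0" "r \<le> j" using r that by auto
      then show False using assms(1)[OF that] assms(2)[of r j] that \<open>f j \<noteq> 0\<close> by simp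
    qed
  next
    assume "j < r"
    then show "f j \<noteq> 0" using not_less_Least[of j "\<lambda>j. j = n \<or> f j = 0"] by (auto simp: r_def)
  qed
qed

text \<open>The eigenvalue at \<open>j\<close> equals the sum over \<open>i\<close> of the squared
  moduli of the \<open>j\<close>-th eigenbasis coordinates of \<open>h i\<close>. If it is zero, all
  these coordinates vanish; if not, the eigenvector equation can be solved for column
  \<open>j\<close> as a combination of the \<open>h i\<close>. Both directions together identify the
  interference space with the span of the leading columns.\<close>

lemma interference_eigenvectors:
  fixes h :: "nat \<Rightarrow> complex vec"
  assumes h: "\<forall>i\<in>{1..U}. h i \<in> carrier_vec M"
    and eig: "sorted_eigen_decomposition M (interference_matrix M U h u) L S"
    and N: "N = interference_dim M U h u"
  shows "N \<le> M"
    and "\<And>i j. i \<in> {1..U} - {u} \<Longrightarrow> N \<le> j \<Longrightarrow> j < M \<Longrightarrow> (mat_adjoint L *\<^sub>v h i) $ j = 0"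
    and "\<And>j. j < N \<Longrightarrow> \<exists>c. col L j = vec M (\<lambda>p. \<Sum>i\<in>{1..U} - {u}. c i * h i $ p)"
    and "interference_space M U h u =
      LinearCombinations.module.span class_ring (module_vec TYPE(complex) M) (col L ` {..<N})"
proof -
  interpret vec_space "TYPE(complex)" M .
  let ?I = "{1..U} - {u}"
  have L: "L \<in> carrier_mat M M" and S: "S \<in> carrier_mat M M" "diagonal_mat S"
    and LL: "mat_adjoint L * L = 1\<^sub>m M"
    and R: "interference_matrix M U h u = L * S * mat_adjoint L"
    and sorted: "\<And>i j. i \<le> j \<Longrightarrow> j < M \<Longrightarrow> Re (S $$ (j, j)) \<le> Re (S $$ (i, i))"
    using eig by (auto simp: sorted_eigen_decomposition_def)
  have LL': "L * mat_adjoint L = 1\<^sub>m M"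
    using mat_mult_left_right_inverse[OF _ L LL] L by simp
  have hI: "h i \<in> carrier_vec M" if "i \<in> ?I" for i using h that by auto
  \<comment> \<open>\<open>a i j\<close> is the coordinate of \<open>h i\<close> along column
    \<open>j\<close> of \<open>L\<close>.\<close>
  define a where "a i j = (mat_adjoint L *\<^sub>v h i) $ j" for i j
  have a: "a i j = (\<Sum>p<M. cnj (L $$ (p, j)) * h i $ p)" if "i \<in> ?I" "j < M" for i j
    using that L hI[OF that(1)]
    by (auto simp: a_def scalar_prod_def mat_adjoint_index lessThan_atLeast0 intro!: sum.cong)
  \<comment> \<open>This is \<open>R * L = L * S\<close> read entrywise, with \<open>R\<close>
    written out as a sum of outer products.\<close>
  have S_col: "(\<Sum>i\<in>?I. h i $ p * cnj (a i j)) = S $$ (j, j) * L $$ (p, j)" if "p < M" "j < M" for p j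
  proof -
    have "interference_matrix M U h u * L = L * S * (mat_adjoint L * L)"
      unfolding R using L S by (intro assoc_mult_mat[of _ M M _ M _ M]) auto
    then have RL: "interference_matrix M U h u * L = L * S" using L S LL by simp
    have "(L * S) $$ (p, j) = (\<Sum>q<M. L $$ (p, q) * S $$ (q, j))"
      using L S that by (simp add: scalar_prod_def lessThan_atLeast0)
    also have "\<dots> = (\<Sum>q<M. if q = j then L $$ (p, j) * S $$ (j, j) else 0)"
      using S that by (intro sum.cong) (auto simp: diagonal_mat_def)
    also have "\<dots> = S $$ (j, j) * L $$ (p, j)" using that by simp
    finally have "S $$ (j, j) * L $$ (p, j) = (interference_matrix M U h u * L) $$ (p, j)"
      by (simp only: RL)
    also have "\<dots> = (\<Sum>q<M. interference_matrix M U h u $$ (p, q) * L $$ (q, j))"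
      using L that by (simp add: scalar_prod_def interference_matrix_def lessThan_atLeast0)
    also have "\<dots> = (\<Sum>q<M. (\<Sum>i\<in>?I. h i $ p * cnj (h i $ q)) * L $$ (q, j))"
    proof -
      have "hermitian_outer (h i) (h i) $$ (p, q) = h i $ p * cnj (h i $ q)"
        if "i \<in> ?I" "q < M" for i q
        using that \<open>p < M\<close> carrier_vecD[OF hI[OF that(1)]] by (simp add: hermitian_outer_def)
      then show ?thesis using that by (simp add: interference_matrix_def)
    qed
    also have "\<dots> = (\<Sum>q<M. \<Sum>i\<in>?I. h i $ p * cnj (h i $ q) * L $$ (q, j))"
      by (simp add: sum_distrib_right)
    also have "\<dots> = (\<Sum>i\<in>?I. \<Sum>q<M. h i $ p * cnj (h i $ q) * L $$ (q, j))"
      by (rule sum.swap)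
    also have "\<dots> = (\<Sum>i\<in>?I. h i $ p * cnj (a i j))"
      using that by (intro sum.cong) (auto simp: a cnj_sum sum_distrib_left mult_ac)
    finally show ?thesis by simp
  qed
  have S_diag: "S $$ (j, j) = complex_of_real (\<Sum>i\<in>?I. (cmod (a i j))\<^sup>2)" if "j < M" for j
  proof -
    \<comment> \<open>The unit norm of column \<open>j\<close> is inserted as a factor, which brings
      the sum into the shape of \<open>S_col\<close>.\<close>
    have "1 = (mat_adjoint L * L) $$ (j, j)" using LL that by simp
    also have "\<dots> = (\<Sum>p<M. cnj (L $$ (p, j)) * L $$ (p, j))"
      using L that by (auto simp: scalar_prod_def mat_adjoint_index lessThan_atLeast0 intro!: sum.cong)
    finally have "S $$ (j, j) = S $$ (j, j) * (\<Sum>p<M. cnj (L $$ (p, j)) * L $$ (p, j))" by simp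
    also have "\<dots> = (\<Sum>p<M. cnj (L $$ (p, j)) * (S $$ (j, j) * L $$ (p, j)))"
      by (simp add: sum_distrib_left mult_ac)
    also have "\<dots> = (\<Sum>p<M. cnj (L $$ (p, j)) * (\<Sum>i\<in>?I. h i $ p * cnj (a i j)))"
      using that by (intro sum.cong refl) (simp only: S_col lessThan_iff)
    also have "\<dots> = (\<Sum>p<M. \<Sum>i\<in>?I. cnj (L $$ (p, j)) * (h i $ p * cnj (a i j)))"
      by (simp add: sum_distrib_left)
    also have "\<dots> = (\<Sum>i\<in>?I. \<Sum>p<M. cnj (L $$ (p, j)) * (h i $ p * cnj (a i j)))"
      by (rule sum.swap)
    also have "\<dots> = (\<Sum>i\<in>?I. a i j * cnj (a i j))"
      using that by (intro sum.cong) (simp_all add: a sum_distrib_right mult.assoc)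
    finally show ?thesis by (simp only: complex_norm_square[symmetric] of_real_sum)
  qed
  have "0 \<le> Re (S $$ (j, j))" if "j < M" for j using S_diag[OF that] by (simp add: sum_nonneg)
  from sorted_nonneg_nonzero_prefix[of M "\<lambda>j. Re (S $$ (j, j))", OF this sorted]
  obtain r where r: "r \<le> M" "\<And>j. j < M \<Longrightarrow> Re (S $$ (j, j)) \<noteq> 0 \<longleftrightarrow> j < r"
    by blast
  have a_0: "a i j = 0" if "i \<in> ?I" "r \<le> j" "j < M" for i j
  proof -
    have "(\<Sum>i\<in>?I. (cmod (a i j))\<^sup>2) = 0"
      using r(2)[OF that(3)] S_diag[OF that(3)] that(2) by simp
    then show ?thesis using that(1) by (simp add: sum_nonneg_eq_0_iff)
  qed
  \<comment> \<open>For \<open>j < r\<close> the equation \<open>S_col\<close> can be divided by the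
    eigenvalue.\<close>
  have col_L: "col L j = vec M (\<lambda>p. \<Sum>i\<in>?I. cnj (a i j) / S $$ (j, j) * h i $ p)" if "j < r" for j
  proof -
    have j: "j < M" and "S $$ (j, j) \<noteq> 0" using that r(1) r(2)[of j] by auto
    then have "L $$ (p, j) = (\<Sum>i\<in>?I. cnj (a i j) / S $$ (j, j) * h i $ p)" if "p < M" for p
      using S_col[OF that j]
      by (simp add: sum_divide_distrib[symmetric] nonzero_eq_divide_eq mult_ac)
    then show ?thesis using L j by (intro eq_vecI) auto
  qed
  have h_col: "h i = vec M (\<lambda>p. \<Sum>j\<in>{..<r}. a i j * col L j $ p)" if "i \<in> ?I" for i
  proof (rule eq_vecI)
    fix p assume "p < dim_vec (vec M (\<lambda>p. \<Sum>j\<in>{..<r}. a i j * col L j $ p))"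
    then have p: "p < M" by simp
    have "h i = (L * mat_adjoint L) *\<^sub>v h i" using LL' hI[OF that] by simp
    also have "\<dots> = L *\<^sub>v (mat_adjoint L *\<^sub>v h i)"
      using L hI[OF that] by (intro assoc_mult_mat_vec) auto
    finally have "h i $ p = (L *\<^sub>v (mat_adjoint L *\<^sub>v h i)) $ p" by simp
    also have "\<dots> = (\<Sum>j<M. L $$ (p, j) * a i j)"
      using L p by (simp add: scalar_prod_def a_def lessThan_atLeast0 del: index_mult_mat_vec)
        (simp add: scalar_prod_def lessThan_atLeast0)
    also have "\<dots> = (\<Sum>j<r. L $$ (p, j) * a i j)"
      using r(1) that by (intro sum.mono_neutral_right) (auto simp: a_0)
    also have "\<dots> = (\<Sum>j\<in>{..<r}. a i j * col L j $ p)"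
      using L p r(1) by (intro sum.cong) (auto simp: mult_ac)
    finally show "h i $ p = vec M (\<lambda>p. \<Sum>j\<in>{..<r}. a i j * col L j $ p) $ p" using p by simp
  qed (use hI[OF that] in auto)
  have col_carrier: "col L j \<in> carrier_vec M" for j using L by auto
  have "span (h ` ?I) = span (col L ` {..<r})"
  proof
    have "h i \<in> span (col L ` {..<r})" if "i \<in> ?I" for i
      unfolding h_col[OF that] by (rule sum_in_span) (auto intro: col_carrier)
    then have "h ` ?I \<subseteq> span (col L ` {..<r})" by blast
    then show "span (h ` ?I) \<subseteq> span (col L ` {..<r})"
      using col_carrier by (intro span_subsetI) auto
    have "col L j \<in> span (h ` ?I)" if "j < r" for j
      unfolding col_L[OF that] by (rule sum_in_span) (auto intro: hI)
    then have "col L ` {..<r} \<subseteq> span (h ` ?I)" by blast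
    moreover have "h ` ?I \<subseteq> carrier_vec M" using hI by blast
    ultimately show "span (col L ` {..<r}) \<subseteq> span (h ` ?I)"
      by (intro span_subsetI)
  qed
  then have space: "interference_space M U h u = span (col L ` {..<r})"
    by (simp add: interference_space_def)
  \<comment> \<open>So far \<open>r\<close> only counts the nonzero eigenvalues; the equality of
    spans makes it the dimension.\<close>
  have "N = r"
    unfolding N interference_dim_def space by (rule dim_span_unitary_cols[OF L LL r(1)])
  show "N \<le> M" using r(1) \<open>N = r\<close> by simp
  show "(mat_adjoint L *\<^sub>v h i) $ j = 0" if "i \<in> ?I" "N \<le> j" "j < M" for i j
    using a_0 that \<open>N = r\<close> by (simp add: a_def)
  show "\<exists>c. col L j = vec M (\<lambda>p. \<Sum>i\<in>?I. c i * h i $ p)" if "j < N" for j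
    using col_L[of j] that \<open>N = r\<close> by (intro exI[of _ "\<lambda>i. cnj (a i j) / S $$ (j, j)"]) simp
  show "interference_space M U h u = span (col L ` {..<N})"
    using space \<open>N = r\<close> by simp
qed

section \<open>Parametrisation of the feasible beamformers\<close>

text \<open>In the coordinates \<open>x = L\<^sup>T w\<close>, with inverse
  \<open>w = L\<^sup>* x\<close>, the constraints say that the first \<open>N\<close> entries of
  \<open>x\<close> vanish, because the first \<open>N\<close> columns of \<open>L\<close> and the
  interfering channels span the same space.\<close>

lemma no_interference_iff:
  fixes h :: "nat \<Rightarrow> complex vec"
  assumes h: "\<forall>i\<in>{1..U}. h i \<in> carrier_vec M"
    and eig: "sorted_eigen_decomposition M (interference_matrix M U h u) L S"
    and N: "N = interference_dim M U h u"
  shows "no_interference M U h u w \<longleftrightarrow>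
    (\<exists>b \<in> carrier_vec (M - N). b \<noteq> 0\<^sub>v (M - N) \<and> w = map_mat cnj L *\<^sub>v (0\<^sub>v N @\<^sub>v b))"
proof -
  note ev = interference_eigenvectors[OF h eig N]
  have L: "L \<in> carrier_mat M M" and LL: "mat_adjoint L * L = 1\<^sub>m M"
    using eig by (auto simp: sorted_eigen_decomposition_def)
  have cL: "map_mat cnj L \<in> carrier_mat M M" using L by simp
  \<comment> \<open>Transposing \<open>L\<^sup>H L = I\<close> shows that \<open>L\<^sup>T\<close>
    and \<open>L\<^sup>*\<close> are inverse to each other.\<close>
  have LT: "transpose_mat L * map_mat cnj L = 1\<^sub>m M"
  proof -
    have "transpose_mat L * map_mat cnj L = transpose_mat (mat_adjoint L * L)"
      using L by (simp add: map_mat_cnj_eq_transpose_adjoint[OF L] transpose_mult[of _ M M _ M])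
    then show ?thesis using LL by simp
  qed
  have LT': "map_mat cnj L * transpose_mat L = 1\<^sub>m M"
    using mat_mult_left_right_inverse[OF _ cL LT] L by simp
  show ?thesis
  proof
    assume w: "no_interference M U h u w"
    then have wc: "w \<in> carrier_vec M" "w \<noteq> 0\<^sub>v M" by (auto simp: no_interference_def)
    define x where "x = transpose_mat L *\<^sub>v w"
    have x: "x \<in> carrier_vec M" using L wc by (auto simp: x_def)
    have "map_mat cnj L *\<^sub>v x = (map_mat cnj L * transpose_mat L) *\<^sub>v w"
      unfolding x_def using cL L wc by (intro assoc_mult_mat_vec[symmetric]) auto
    then have wx: "w = map_mat cnj L *\<^sub>v x" using LT' wc by simp
    \<comment> \<open>Column \<open>j\<close> is a combination of interfering channels, each of
      which has bilinear product zero with \<open>w\<close>.\<close>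
    have "x $ j = 0" if j: "j < N" for j
    proof -
      obtain c where c: "col L j = vec M (\<lambda>p. \<Sum>i\<in>{1..U} - {u}. c i * h i $ p)"
        using ev(3)[OF j] by blast
      have "x $ j = col L j \<bullet> w" using L j ev(1) by (simp add: x_def)
      also have "\<dots> = (\<Sum>p<M. \<Sum>i\<in>{1..U} - {u}. c i * (h i $ p * w $ p))"
        unfolding c using wc by (simp add: scalar_prod_def lessThan_atLeast0 sum_distrib_right mult.assoc)
      also have "\<dots> = (\<Sum>i\<in>{1..U} - {u}. \<Sum>p<M. c i * (h i $ p * w $ p))"
        by (rule sum.swap)
      also have "\<dots> = (\<Sum>i\<in>{1..U} - {u}. c i * (h i \<bullet> w))"
        using wc by (simp add: scalar_prod_def lessThan_atLeast0 sum_distrib_left)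
      also have "\<dots> = 0" using w by (intro sum.neutral) (auto simp: no_interference_def)
      finally show ?thesis .
    qed
    then have "x = 0\<^sub>v N @\<^sub>v vec (M - N) (\<lambda>j. x $ (N + j))"
      using x ev(1) by (intro eq_vecI) auto
    moreover have "vec (M - N) (\<lambda>j. x $ (N + j)) \<noteq> 0\<^sub>v (M - N)"
    proof
      assume *: "vec (M - N) (\<lambda>j. x $ (N + j)) = 0\<^sub>v (M - N)"
      have "0\<^sub>v N @\<^sub>v 0\<^sub>v (M - N) = (0\<^sub>v M :: complex vec)" using ev(1) by (intro eq_vecI) auto
      then have "x = 0\<^sub>v M" using calculation unfolding * by simp
      moreover have "map_mat cnj L *\<^sub>v 0\<^sub>v M = 0\<^sub>v M" using cL by (intro eq_vecI) auto
      ultimately have "w = 0\<^sub>v M" using wx by (simp only:)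
      then show False using wc(2) by contradiction
    qed
    ultimately show "\<exists>b \<in> carrier_vec (M - N). b \<noteq> 0\<^sub>v (M - N) \<and> w = map_mat cnj L *\<^sub>v (0\<^sub>v N @\<^sub>v b)"
      using wx by (intro bexI[of _ "vec (M - N) (\<lambda>j. x $ (N + j))"]) auto
  next
    assume "\<exists>b \<in> carrier_vec (M - N). b \<noteq> 0\<^sub>v (M - N) \<and> w = map_mat cnj L *\<^sub>v (0\<^sub>v N @\<^sub>v b)"
    then obtain b where b: "b \<in> carrier_vec (M - N)" "b \<noteq> 0\<^sub>v (M - N)"
      and w: "w = map_mat cnj L *\<^sub>v (0\<^sub>v N @\<^sub>v b)" by blast
    have x: "0\<^sub>v N @\<^sub>v b \<in> carrier_vec M" using b ev(1) by (intro carrier_vecI) auto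
    have wc: "w \<in> carrier_vec M" using cL x by (auto simp: w)
    have "transpose_mat L *\<^sub>v w = (transpose_mat L * map_mat cnj L) *\<^sub>v (0\<^sub>v N @\<^sub>v b)"
      unfolding w using cL L x by (intro assoc_mult_mat_vec[symmetric]) auto
    then have wx: "transpose_mat L *\<^sub>v w = 0\<^sub>v N @\<^sub>v b" using LT x by simp
    have "w \<noteq> 0\<^sub>v M"
    proof
      assume "w = 0\<^sub>v M"
      moreover have "transpose_mat L *\<^sub>v 0\<^sub>v M = 0\<^sub>v M" using L by (intro eq_vecI) auto
      ultimately have "0\<^sub>v N @\<^sub>v b = 0\<^sub>v M" using wx by (simp only:)
      then have zero: "(0\<^sub>v N @\<^sub>v b) $ (N + j) = 0" if "j < M - N" for j using that by simp
      have "b $ j = 0" if "j < M - N" for j using zero[OF that] that b(1) by simp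
      then show False using b by (auto simp: vec_eq_iff)
    qed
    \<comment> \<open>\<open>L\<^sup>H h i\<close> vanishes from position \<open>N\<close> on and
      the padded \<open>b\<close> before it, so every term of their product is zero.\<close>
    moreover have "h i \<bullet> w = 0" if i: "i \<in> {1..U} - {u}" for i
    proof -
      have hi: "h i \<in> carrier_vec M" using h i by auto
      have "h i \<bullet> w = w \<bullet> h i" using hi wc by (rule comm_scalar_prod)
      also have "\<dots> = (0\<^sub>v N @\<^sub>v b) \<bullet> (mat_adjoint L *\<^sub>v h i)"
        unfolding w by (rule map_mat_cnj_scalar_prod[OF L x hi])
      also have "\<dots> = (\<Sum>j<M. (0\<^sub>v N @\<^sub>v b) $ j * (mat_adjoint L *\<^sub>v h i) $ j)"
        using L unfolding scalar_prod_def by (simp add: lessThan_atLeast0 del: index_mult_mat_vec)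
      also have "\<dots> = 0"
        using b(1) ev(1) ev(2)[OF i] by (intro sum.neutral) (auto simp del: index_mult_mat_vec)
      finally show ?thesis .
    qed
    ultimately show "no_interference M U h u w" using wc by (simp add: no_interference_def)
  qed
qed

section \<open>The impedance form on the feasible vectors\<close>

lemma zero_append_scalar_prod:
  fixes b y :: "'a :: comm_ring_1 vec"
  assumes "b \<in> carrier_vec m" "x \<in> carrier_vec n" "y \<in> carrier_vec m"
  shows "(0\<^sub>v n @\<^sub>v b) \<bullet> (x @\<^sub>v y) = b \<bullet> y"
  using assms by (subst scalar_prod_append[of _ n _ m]) auto

text \<open>Conjugation turns the right factor \<open>L\<^sup>*\<close> into \<open>L\<close>, and
  the left one crosses the product as \<open>L\<^sup>H\<close>. The matrix in between is
  \<open>L\<^sup>H Z L\<close>, and zero padding on both sides leaves only its lower right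
  block.\<close>

lemma form_on_complement:
  fixes L Z :: "complex mat"
  assumes L: "L \<in> carrier_mat M M" and Z: "Z \<in> carrier_mat M M" and N: "N \<le> M"
    and blocks: "Upsilon \<in> carrier_mat N N" "Psi \<in> carrier_mat N (M - N)"
      "Xi \<in> carrier_mat (M - N) (M - N)"
      "mat_adjoint L * Z * L = four_block_mat Upsilon Psi (mat_adjoint Psi) Xi"
    and a: "a \<in> carrier_vec (M - N)" and b: "b \<in> carrier_vec (M - N)"
  shows "(map_mat cnj L *\<^sub>v (0\<^sub>v N @\<^sub>v a)) \<bullet>
      (Z *\<^sub>v conjugate (map_mat cnj L *\<^sub>v (0\<^sub>v N @\<^sub>v b))) = a \<bullet> (Xi *\<^sub>v conjugate b)"
proof -
  have x: "0\<^sub>v N @\<^sub>v a \<in> carrier_vec M" using a N by (intro carrier_vecI) auto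
  have y: "0\<^sub>v N @\<^sub>v b \<in> carrier_vec M" using b N by (intro carrier_vecI) auto
  have cb: "0\<^sub>v N @\<^sub>v conjugate b \<in> carrier_vec M" using b N by (intro carrier_vecI) auto
  have "conjugate (0\<^sub>v N @\<^sub>v b) = 0\<^sub>v N @\<^sub>v conjugate b" by (intro eq_vecI) auto
  moreover have "map_mat cnj (map_mat cnj L) = L" by (intro eq_matI) auto
  ultimately have conj: "conjugate (map_mat cnj L *\<^sub>v (0\<^sub>v N @\<^sub>v b)) = L *\<^sub>v (0\<^sub>v N @\<^sub>v conjugate b)"
    using conjugate_mult_mat_vec[of "map_mat cnj L" M M, OF _ y] L by simp
  have "(map_mat cnj L *\<^sub>v (0\<^sub>v N @\<^sub>v a)) \<bullet> (Z *\<^sub>v (L *\<^sub>v (0\<^sub>v N @\<^sub>v conjugate b)))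
      = (0\<^sub>v N @\<^sub>v a) \<bullet> (mat_adjoint L *\<^sub>v (Z *\<^sub>v (L *\<^sub>v (0\<^sub>v N @\<^sub>v conjugate b))))"
    using L Z cb by (intro map_mat_cnj_scalar_prod[OF L x]) auto
  also have "mat_adjoint L *\<^sub>v (Z *\<^sub>v (L *\<^sub>v (0\<^sub>v N @\<^sub>v conjugate b)))
      = (mat_adjoint L * Z * L) *\<^sub>v (0\<^sub>v N @\<^sub>v conjugate b)"
    using L Z cb mat_adjoint_carrier[OF L]
    by (simp add: assoc_mult_mat_vec[of "mat_adjoint L * Z" M M L M] assoc_mult_mat_vec[of "mat_adjoint L" M M Z M]
      mult_carrier_mat[of _ M M _ M] mult_mat_vec_carrier[of _ M M])
  also have "\<dots> = (Upsilon *\<^sub>v 0\<^sub>v N + Psi *\<^sub>v conjugate b) @\<^sub>v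
      (mat_adjoint Psi *\<^sub>v 0\<^sub>v N + Xi *\<^sub>v conjugate b)"
    unfolding blocks(4) using blocks b by (intro four_block_mat_mult_vec) auto
  also have "mat_adjoint Psi *\<^sub>v 0\<^sub>v N + Xi *\<^sub>v conjugate b = Xi *\<^sub>v conjugate b"
  proof -
    have "mat_adjoint Psi *\<^sub>v 0\<^sub>v N = 0\<^sub>v (M - N)"
      using blocks(2) by (auto intro!: eq_vecI)
    then show ?thesis using blocks(3) b by auto
  qed
  also have "(0\<^sub>v N @\<^sub>v a) \<bullet> ((Upsilon *\<^sub>v 0\<^sub>v N + Psi *\<^sub>v conjugate b) @\<^sub>v (Xi *\<^sub>v conjugate b))
      = a \<bullet> (Xi *\<^sub>v conjugate b)"
    using a b blocks by (intro zero_append_scalar_prod) auto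
  finally show ?thesis unfolding conj .
qed

text \<open>A trivial kernel gives a nonzero determinant, hence a unit of the matrix ring, which
  rules out \<open>None\<close>. Only then does \<open>the (mat_inverse A)\<close> denote the
  inverse.\<close>

lemma mat_inverse_of_injective:
  fixes A :: "'a :: field mat"
  assumes A: "A \<in> carrier_mat n n" and inj: "\<And>x. x \<in> carrier_vec n \<Longrightarrow> A *\<^sub>v x = 0\<^sub>v n \<Longrightarrow> x = 0\<^sub>v n"
  obtains B where "mat_inverse A = Some B" "B \<in> carrier_mat n n" "A * B = 1\<^sub>m n" "B * A = 1\<^sub>m n"
proof -
  have "det A \<noteq> 0" using det_0_iff_vec_prod_zero[OF A] inj by blast
  then have "A \<in> Units (ring_mat TYPE('a) n ())" by (rule det_non_zero_imp_unit[OF A])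
  then obtain B where "mat_inverse A = Some B"
    using mat_inverse(1)[OF A, where b = "()"] by (cases "mat_inverse A") auto
  then show ?thesis using that mat_inverse(2)[OF A] by blast
qed

section \<open>The optimal beamformer\<close>

text \<open>The representation condition on the feasible vectors reads
  \<open>Xi *\<^sub>v conjugate alpha = eta\<close>; solved for \<open>alpha\<close> it involves the
  inverse of the conjugate of \<open>Xi\<close>. Were \<open>h u\<close> in the interference space,
  \<open>eta\<close> and \<open>wbar\<close> would vanish and every feasible vector would have gain
  zero; hence the premise of the second conjunct.\<close>

theorem theorem1:
  fixes M U u N :: nat and lam d :: real
    and h :: "nat \<Rightarrow> complex vec"
    and Z L S Upsilon Psi Xi :: "complex mat"
    and gamma eta alpha wbar :: "complex vec"
  assumes d: "0 < d" "d < lam / 2"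
    and Z: "Z = map_mat complex_of_real (impedance_matrix lam d M)"
    and h: "\<And>i. i \<in> {1..U} \<Longrightarrow> h i \<in> carrier_vec M"
    and u: "u \<in> {1..U}"
    and N: "N = interference_dim M U h u"
    and eig: "sorted_eigen_decomposition M (interference_matrix M U h u) L S"
    and blocks: "Upsilon \<in> carrier_mat N N" "Psi \<in> carrier_mat N (M - N)"
      "Xi \<in> carrier_mat (M - N) (M - N)"
      "mat_adjoint L * Z * L = four_block_mat Upsilon Psi (mat_adjoint Psi) Xi"
    and parts: "gamma \<in> carrier_vec N" "eta \<in> carrier_vec (M - N)"
      "mat_adjoint L *\<^sub>v h u = gamma @\<^sub>v eta"
    and alpha: "alpha = the (mat_inverse (map_mat cnj Xi)) *\<^sub>v conjugate eta"
    and wbar: "wbar = map_mat cnj L *\<^sub>v (0\<^sub>v N @\<^sub>v alpha)"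
  shows "invertible_mat Xi \<and>
    (h u \<notin> interference_space M U h u \<longrightarrow>
      (\<forall>w. is_arg_max (power_gain Z (h u)) (no_interference M U h u) w \<longleftrightarrow>
           (\<exists>c. c \<noteq> 0 \<and> w = c \<cdot>\<^sub>v wbar)))"
proof -
  have hc: "\<forall>i\<in>{1..U}. h i \<in> carrier_vec M" using h by blast
  note ev = interference_eigenvectors[OF hc eig N]
  note feasible_iff = no_interference_iff[OF hc eig N]
  have L: "L \<in> carrier_mat M M" and LL: "mat_adjoint L * L = 1\<^sub>m M"
    using eig by (auto simp: sorted_eigen_decomposition_def)
  have Zc: "Z \<in> carrier_mat M M" by (simp add: Z)
  have cL: "map_mat cnj L \<in> carrier_mat M M" using L by simp
  note form = form_on_complement[OF L Zc ev(1) blocks]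
  have pos: "0 < Re (w \<bullet> (Z *\<^sub>v conjugate w))" if "w \<in> carrier_vec M" "w \<noteq> 0\<^sub>v M" for w
    unfolding Z by (rule impedance_form_pos[OF d that])
  \<comment> \<open>A nonzero kernel vector of \<open>Xi\<close> would yield a feasible beamformer
    on which the positive form of \<open>Z\<close> is zero.\<close>
  have Xi_inj: "x = 0\<^sub>v (M - N)" if x: "x \<in> carrier_vec (M - N)" "Xi *\<^sub>v x = 0\<^sub>v (M - N)" for x
  proof (rule ccontr)
    assume "x \<noteq> 0\<^sub>v (M - N)"
    then have "conjugate x \<noteq> 0\<^sub>v (M - N)" using x(1) by simp
    then have "no_interference M U h u (map_mat cnj L *\<^sub>v (0\<^sub>v N @\<^sub>v conjugate x))"
      using feasible_iff x(1) carrier_vec_conjugate by blast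
    then have "0 < Re (conjugate x \<bullet> (Xi *\<^sub>v conjugate (conjugate x)))"
      unfolding form[OF carrier_vec_conjugate[OF x(1)] carrier_vec_conjugate[OF x(1)], symmetric]
      by (intro pos) (simp_all add: no_interference_def)
    then show False using x by simp
  qed
  obtain B where B: "B \<in> carrier_mat (M - N) (M - N)" "Xi * B = 1\<^sub>m (M - N)" "B * Xi = 1\<^sub>m (M - N)"
    using mat_inverse_of_injective[OF blocks(3) Xi_inj] by blast
  then have inv: "invertible_mat Xi"
    using blocks(3) by (auto simp: invertible_mat_def inverts_mat_def)
  have cXi: "map_mat cnj Xi \<in> carrier_mat (M - N) (M - N)" using blocks(3) by simp
  have cXi_inj: "x = 0\<^sub>v (M - N)"
    if x: "x \<in> carrier_vec (M - N)" "map_mat cnj Xi *\<^sub>v x = 0\<^sub>v (M - N)" for x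
  proof -
    have "conjugate (Xi *\<^sub>v conjugate x) = 0\<^sub>v (M - N)"
      using conjugate_mult_mat_vec[OF blocks(3), of "conjugate x"] x by simp
    then have "Xi *\<^sub>v conjugate x = 0\<^sub>v (M - N)" using blocks(3) by simp
    then show ?thesis using Xi_inj[of "conjugate x"] x(1) by simp
  qed
  obtain C where C: "mat_inverse (map_mat cnj Xi) = Some C" "C \<in> carrier_mat (M - N) (M - N)"
      "map_mat cnj Xi * C = 1\<^sub>m (M - N)"
    using mat_inverse_of_injective[OF cXi cXi_inj] by blast
  have alphac: "alpha \<in> carrier_vec (M - N)" using C parts(2) by (auto simp: alpha)
  have "map_mat cnj Xi *\<^sub>v alpha = conjugate eta"
  proof -
    have "map_mat cnj Xi *\<^sub>v alpha = (map_mat cnj Xi * C) *\<^sub>v conjugate eta"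
      unfolding alpha C(1) option.sel using cXi C parts(2)
      by (intro assoc_mult_mat_vec[symmetric]) auto
    then show ?thesis using C parts(2) by simp
  qed
  \<comment> \<open>Conjugating the equation that defines \<open>alpha\<close> gives the
    representation condition.\<close>
  then have "conjugate (Xi *\<^sub>v conjugate alpha) = conjugate eta"
    using conjugate_mult_mat_vec[OF blocks(3), of "conjugate alpha"] alphac by simp
  then have Xi_alpha: "Xi *\<^sub>v conjugate alpha = eta" by simp
  have hu: "h u \<in> carrier_vec M" using h u by simp
  have "is_arg_max (power_gain Z (h u)) (no_interference M U h u) w \<longleftrightarrow>
      (\<exists>c. c \<noteq> 0 \<and> w = c \<cdot>\<^sub>v wbar)" if hu_notin: "h u \<notin> interference_space M U h u" for w
  proof (rule is_arg_max_power_gain_iff[OF Zc hu])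
    \<comment> \<open>With \<open>eta\<close> zero, \<open>h u\<close> would be a combination of the
      first \<open>N\<close> columns of \<open>L\<close>, which lie in the interference
      space.\<close>
    have "eta \<noteq> 0\<^sub>v (M - N)"
    proof
      assume eta: "eta = 0\<^sub>v (M - N)"
      have LL': "L * mat_adjoint L = 1\<^sub>m M"
        using mat_mult_left_right_inverse[OF _ L LL] L by simp
      have "h u = (L * mat_adjoint L) *\<^sub>v h u" using LL' hu by simp
      also have "\<dots> = L *\<^sub>v (mat_adjoint L *\<^sub>v h u)"
        using L hu by (intro assoc_mult_mat_vec) auto
      also have "\<dots> = L *\<^sub>v (gamma @\<^sub>v 0\<^sub>v (M - N))" by (simp only: parts(3) eta)
      also have "\<dots> = vec M (\<lambda>p. \<Sum>j\<in>{..<N}. gamma $ j * col L j $ p)"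
      proof (rule eq_vecI)
        fix p assume "p < dim_vec (vec M (\<lambda>p. \<Sum>j\<in>{..<N}. gamma $ j * col L j $ p))"
        then have p: "p < M" by simp
        have "(L *\<^sub>v (gamma @\<^sub>v 0\<^sub>v (M - N))) $ p
            = (\<Sum>j<M. L $$ (p, j) * (gamma @\<^sub>v 0\<^sub>v (M - N)) $ j)"
          using L p parts(1) ev(1) by (auto simp: scalar_prod_def lessThan_atLeast0 intro!: sum.cong)
        also have "\<dots> = (\<Sum>j<N. L $$ (p, j) * (gamma @\<^sub>v 0\<^sub>v (M - N)) $ j)"
          using ev(1) parts(1) by (intro sum.mono_neutral_right) auto
        also have "\<dots> = (\<Sum>j\<in>{..<N}. gamma $ j * col L j $ p)"
          using L p ev(1) parts(1) by (intro sum.cong) auto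
        finally show "(L *\<^sub>v (gamma @\<^sub>v 0\<^sub>v (M - N))) $ p
            = vec M (\<lambda>p. \<Sum>j\<in>{..<N}. gamma $ j * col L j $ p) $ p" using p by simp
      qed (use L in auto)
      also have "\<dots> \<in> interference_space M U h u"
        unfolding ev(4) using L by (intro sum_in_span) auto
      finally show False using hu_notin by simp
    qed
    moreover have "Xi *\<^sub>v 0\<^sub>v (M - N) = 0\<^sub>v (M - N)"
      using blocks(3) by (intro eq_vecI) auto
    ultimately have "alpha \<noteq> 0\<^sub>v (M - N)" using Xi_alpha by auto
    show "no_interference M U h u (c \<cdot>\<^sub>v wbar)" if "c \<noteq> 0" for c
    proof -
      have "c \<cdot>\<^sub>v alpha \<noteq> 0\<^sub>v (M - N)"
        using \<open>alpha \<noteq> 0\<^sub>v (M - N)\<close> alphac that by (auto simp: vec_eq_iff)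
      moreover have "c \<cdot>\<^sub>v (0\<^sub>v N @\<^sub>v alpha) = 0\<^sub>v N @\<^sub>v c \<cdot>\<^sub>v alpha"
        by (intro eq_vecI) auto
      moreover have "c \<cdot>\<^sub>v wbar = map_mat cnj L *\<^sub>v (c \<cdot>\<^sub>v (0\<^sub>v N @\<^sub>v alpha))"
        unfolding wbar using alphac ev(1) by (intro mult_mat_vec[OF cL, symmetric] carrier_vecI) auto
      ultimately show ?thesis
        using feasible_iff[of "c \<cdot>\<^sub>v wbar"] alphac by auto
    qed
    \<comment> \<open>Both sides equal \<open>b \<bullet> eta\<close>: on the left by the choice of
      \<open>alpha\<close>, on the right because \<open>gamma\<close> meets the zero
      padding.\<close>
    show "w \<bullet> (Z *\<^sub>v conjugate wbar) = w \<bullet> h u" if feasible: "no_interference M U h u w" for w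
    proof -
      obtain b where b: "b \<in> carrier_vec (M - N)" and w: "w = map_mat cnj L *\<^sub>v (0\<^sub>v N @\<^sub>v b)"
        using iffD1[OF feasible_iff feasible] by blast
      have "w \<bullet> (Z *\<^sub>v conjugate wbar) = b \<bullet> eta"
        unfolding w wbar form[OF b alphac] Xi_alpha ..
      moreover have "w \<bullet> h u = (0\<^sub>v N @\<^sub>v b) \<bullet> (gamma @\<^sub>v eta)"
        unfolding w parts(3)[symmetric] using b ev(1)
        by (intro map_mat_cnj_scalar_prod[OF L _ hu] carrier_vecI) auto
      ultimately show ?thesis using zero_append_scalar_prod[OF b parts(1,2)] by simp
    qed
    show "v \<bullet> (Z *\<^sub>v conjugate w) = cnj (w \<bullet> (Z *\<^sub>v conjugate v))"
      if "v \<in> carrier_vec M" "w \<in> carrier_vec M" for v w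
      using that Z by (rule impedance_form_hermitian)
  qed (use pos in \<open>auto simp: no_interference_def\<close>)
  with inv show ?thesis by blast
qed

end
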